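(* Let $\langle X,d\rangle$ be a metric space. Each uniformly star superparacompact subset of $X$ is a uniformly paracompact subset of $X$.
   Context: Metric spaces are assumed to contain at least two points. $S_d(x,\varepsilon)$ denotes the open ball. For $x\in X$ and $\varepsilon>0$, $S^\infty_d(x,\varepsilon)$ is the set of all $y\in X$ for which there is a finite sequence $x=x_0,x_1,\dots,x_n=y$ in $X$ with $d(x_{i-1},x_i)<\varepsilon$ for $i=1,\dots,n$. Define $f_c(x)=\sup\{\varepsilon>0: S^\infty_d(x,\varepsilon)\text{ is compact}\}\in[0,\infty]$ if $S^\infty_d(x,\varepsilon)$ is compact for some $\varepsilon>0$, and $f_c(x)=0$ otherwise. Define $\nu(x)=\sup\{\varepsilon>0:\operatorname{cl}(S_d(x,\varepsilon))\text{ is compact}\}\in[0,\infty]$ if $x$ has a compact neighborhood, and $\nu(x)=0$ otherwise. A nonempty subset $A$ of $X$ is a uniformly star superparacompact subset if every sequence $\langle a_n\rangle$ in $A$ with $\lim_{n\to\infty}f_c(a_n)=0$ has a cluster point in $X$. A nonempty subset $A$ of $X$ is a uniformly paracompact subset (also called cofinally complete subset) if every sequence $\langle a_n\rangle$ in $A$ with $\lim_{n\to\infty}\nu(a_n)=0$ has a cluster point in $X$. *)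

theory Defs
  imports "HOL-Analysis.Analysis"
begin

definition chain_ball :: "'a::metric_space \<Rightarrow> real \<Rightarrow> 'a set" where
  "chain_ball x \<epsilon> =
     {y. \<exists>(n::nat) s. s 0 = x \<and> s n = y \<and> (\<forall>i\<in>{1..n}. dist (s (i - 1)) (s i) < \<epsilon>)}"

definition f_c :: "'a::metric_space \<Rightarrow> ennreal" where
  "f_c x = (if \<exists>\<epsilon>>0. compact (chain_ball x \<epsilon>)
            then Sup {ennreal \<epsilon> |\<epsilon>. \<epsilon> > 0 \<and> compact (chain_ball x \<epsilon>)} else 0)"

definition local_compactness :: "'a::metric_space \<Rightarrow> ennreal" ("\<nu>") where
  "\<nu> x = (if \<exists>K. compact K \<and> x \<in> interior K
          then Sup {ennreal \<epsilon> |\<epsilon>. \<epsilon> > 0 \<and> compact (closure (ball x \<epsilon>))} else 0)"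

(* Cluster points of the sequence, not limit points of its range:
   a value taken infinitely often is a cluster point. *)
definition seq_cluster_point :: "(nat \<Rightarrow> 'a::topological_space) \<Rightarrow> 'a \<Rightarrow> bool" where
  "seq_cluster_point a x \<longleftrightarrow>
     (\<forall>U. open U \<and> x \<in> U \<longrightarrow> (\<exists>\<^sub>F n in sequentially. a n \<in> U))"

definition uniformly_star_superparacompact_subset :: "'a::metric_space set \<Rightarrow> bool" where
  "uniformly_star_superparacompact_subset A \<longleftrightarrow> A \<noteq> {} \<and>
     (\<forall>a. (\<forall>n. a n \<in> A) \<and> (\<lambda>n. f_c (a n)) \<longlonglongrightarrow> 0 \<longrightarrow> (\<exists>x. seq_cluster_point a x))"

definition uniformly_paracompact_subset :: "'a::metric_space set \<Rightarrow> bool" where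
  "uniformly_paracompact_subset A \<longleftrightarrow> A \<noteq> {} \<and>
     (\<forall>a. (\<forall>n. a n \<in> A) \<and> (\<lambda>n. \<nu> (a n)) \<longlonglongrightarrow> 0 \<longrightarrow> (\<exists>x. seq_cluster_point a x))"

end

theory Submission
  imports Defs
begin

text \<open>
  The whole content is the pointwise inequality \<open>f_c \<le> \<nu>\<close>. A chain ball contains the ordinary
  ball of the same radius, because a single step is already a chain; so if the chain ball is
  compact, the closure of the ball is a closed subset of a compact set and hence compact. Every
  radius that counts for \<open>f_c\<close> therefore counts for \<open>\<nu>\<close>. Consequently a sequence along which \<open>\<nu>\<close>
  tends to zero is one along which \<open>f_c\<close> tends to zero, and its cluster point is supplied by
  star superparacompactness.
\<close>

lemma ball_subset_chain_ball: "ball x \<epsilon> \<subseteq> chain_ball x \<epsilon>"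
proof
  fix y assume "y \<in> ball x \<epsilon>"
  then show "y \<in> chain_ball x \<epsilon>"
    unfolding chain_ball_def
    by (auto intro!: exI[of _ "Suc 0"] exI[of _ "\<lambda>i. if i = 0 then x else y"])
qed

lemma compact_closure_ball_if_compact_chain_ball:
  assumes "compact (chain_ball x \<epsilon>)"
  shows "compact (closure (ball x \<epsilon>))"
proof -
  have "closure (ball x \<epsilon>) \<subseteq> chain_ball x \<epsilon>"
    by (intro closure_minimal ball_subset_chain_ball compact_imp_closed assms)
  then show ?thesis
    using compact_Int_closed[OF assms closed_closure[of "ball x \<epsilon>"]]
    by (simp add: Int_absorb1)
qed

text \<open>
  The two case distinctions agree in the needed direction: a compact chain ball of positive
  radius is itself a compact neighbourhood of its centre, so \<open>\<nu>\<close> is then given by its supremum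
  and not by the default value.
\<close>
lemma f_c_le_local_compactness: "f_c x \<le> \<nu> x"
proof (cases "\<exists>\<epsilon>>0. compact (chain_ball x \<epsilon>)")
  case True
  then obtain \<epsilon> where "\<epsilon> > 0" "compact (chain_ball x \<epsilon>)"
    by blast
  moreover from this have "x \<in> interior (chain_ball x \<epsilon>)"
    by (meson ball_subset_chain_ball centre_in_ball interior_maximal open_ball subsetD)
  ultimately have "\<exists>K. compact K \<and> x \<in> interior K"
    by blast
  moreover have "Sup {ennreal \<epsilon> |\<epsilon>. \<epsilon> > 0 \<and> compact (chain_ball x \<epsilon>)}
      \<le> Sup {ennreal \<epsilon> |\<epsilon>. \<epsilon> > 0 \<and> compact (closure (ball x \<epsilon>))}"
    by (intro Sup_subset_mono) (auto intro: compact_closure_ball_if_compact_chain_ball)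
  ultimately show ?thesis
    using True by (simp add: f_c_def local_compactness_def)
next
  case False
  then have "f_c x = 0"
    unfolding f_c_def by (rule if_not_P)
  then show ?thesis by simp
qed

theorem mainTheorem2:
  fixes A :: "'a::metric_space set"
  assumes "\<exists>x y :: 'a. x \<noteq> y"
    and "uniformly_star_superparacompact_subset A"
  shows "uniformly_paracompact_subset A"
  unfolding uniformly_paracompact_subset_def
proof (intro conjI allI impI)
  show "A \<noteq> {}"
    using assms(2) by (simp add: uniformly_star_superparacompact_subset_def)
next
  fix a :: "nat \<Rightarrow> 'a"
  assume a: "(\<forall>n. a n \<in> A) \<and> (\<lambda>n. \<nu> (a n)) \<longlonglongrightarrow> 0"
  have "(\<lambda>n. f_c (a n)) \<longlonglongrightarrow> 0"
    by (rule tendsto_sandwich[OF _ _ tendsto_const conjunct2[OF a]])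
      (simp_all add: f_c_le_local_compactness)
  with a show "\<exists>x. seq_cluster_point a x"
    using assms(2) by (simp add: uniformly_star_superparacompact_subset_def)
qed

end
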